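(* Let $\Gamma$ be a countable group endowed with a length $\ell$. If $\Gamma$ has polynomial branching with respect to $\ell$, then $\Gamma$ has property RD with respect to $\ell$.
   Context: A length on $\Gamma$ is a function $\ell:\Gamma\to[0,\infty)$ with $\ell(e)=0$, $\ell(x)=\ell(x^{-1})$ and $\ell(xy)\le \ell(x)+\ell(y)$; write $|x|=\ell(x)$ and $B_r=\{x\in\Gamma : |x|\le r\}$. Property RD with respect to $\ell$: there is a polynomial $P$ such that $\|f*g\|_2\le P(r)\|f\|_2\|g\|_2$ for all $r\ge 0$ and all $f,g\in\mathbb{C}\Gamma$ with $\mathrm{supp}(f)\subset B_r$ (here $*$ is convolution and $\|\cdot\|_2$ is the $\ell^2$-norm). A triangle in $\Gamma$ is a triple $(x,y,z)\in\Gamma^3$ with $xy=z$. A 3-path from $e$ to $z$ is a triple $(a_3,a_2,a_1)\in\Gamma^3$ with $z=a_3a_2a_1$. For $\kappa\ge 1$, $\delta\ge 0$ it is $(\kappa,\delta)$-geodesic if $|a_1|+|a_2|+|a_3|\le\kappa|a_3a_2a_1|+\delta$. Let $C=(C_z^r)_{z\in\Gamma,\ r\in\{1,2,\dots\}}$ be a family in which each $C_z^r$ is a set of 3-paths from $e$ to $z$. It has polynomial growth if there is a polynomial $p_1$ with $\#C_z^r\le p_1(r)$ for all $z,r$. For a triangle $(u,v,w)$ and an integer $r\ge1$ let $D^r_{(u,v,w)}$ be the set of $(a,b,c)\in\Gamma^3$ with $(a^{-1},u,b)\in C^r_{a^{-1}ub}$, $(b^{-1},v,c)\in C^r_{b^{-1}vc}$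 and $(a^{-1},w,c)\in C^r_{a^{-1}wc}$. Given sets $\mathfrak{s},\mathfrak{s}^-$ of triangles, $\mathfrak{s}^-$ is a retract of $\mathfrak{s}$ along $C$ if there is a polynomial $p_2$ such that for every $(x,y,z)\in\mathfrak{s}$ there are $(u,v,w)\in\mathfrak{s}^-$ with $|u|\le p_2(|x|)$ and $(a,b,c)\in D^{r}_{(u,v,w)}$, where $r=\max(1,\lceil |x|\rceil)$, such that $a^{-1}ub=x$ and $a^{-1}wc=z$ (hence $b^{-1}vc=y$). $\Gamma$ has polynomial branching with respect to $\ell$ if there exist $\kappa\ge1$, $\delta\ge0$, a family $C=(C_z^r)$ of polynomial growth with each $C_z^r$ consisting of $(\kappa,\delta)$-geodesic 3-paths from $e$ to $z$, a set $\mathfrak{s}$ of triangles of $\Gamma$ which is a retract along $C$ of the set of all triangles of $\Gamma$, and a polynomial $p_3$ such that for every $z\in\Gamma$ and every $r\ge 0$ the number of triangles $(x,y,z)\in\mathfrak{s}$ with $|x|\le r$ is at most $p_3(r)$. *)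

theory Defs
  imports
    "HOL-Algebra.Group"
    "HOL-Computational_Algebra.Polynomial"
    "HOL-Analysis.L2_Norm"
    "HOL-Library.Countable_Set"
begin

definition length_function :: "('a, 'm) monoid_scheme \<Rightarrow> ('a \<Rightarrow> real) \<Rightarrow> bool" where
  "length_function G l \<longleftrightarrow>
     (\<forall>x\<in>carrier G. 0 \<le> l x) \<and>
     l \<one>\<^bsub>G\<^esub> = 0 \<and>
     (\<forall>x\<in>carrier G. l (inv\<^bsub>G\<^esub> x) = l x) \<and>
     (\<forall>x\<in>carrier G. \<forall>y\<in>carrier G. l (x \<otimes>\<^bsub>G\<^esub> y) \<le> l x + l y)"

definition length_ball :: "('a, 'm) monoid_scheme \<Rightarrow> ('a \<Rightarrow> real) \<Rightarrow> real \<Rightarrow> 'a set" where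
  "length_ball G l r = {x \<in> carrier G. l x \<le> r}"


subsection \<open>The complex group algebra and property RD\<close>

definition supp :: "('a \<Rightarrow> complex) \<Rightarrow> 'a set" where
  "supp f = {x. f x \<noteq> 0}"

definition group_algebra :: "('a, 'm) monoid_scheme \<Rightarrow> ('a \<Rightarrow> complex) set" where
  "group_algebra G = {f. finite (supp f) \<and> supp f \<subseteq> carrier G}"

text \<open>Elements of the group algebra, and hence their convolutions, vanish outside the carrier.
  The sums below are finite for elements of the group algebra, since they range over supports.\<close>

definition convolution ::
  "('a, 'm) monoid_scheme \<Rightarrow> ('a \<Rightarrow> complex) \<Rightarrow> ('a \<Rightarrow> complex) \<Rightarrow> 'a \<Rightarrow> complex" where
  "convolution G f g z =
     (if z \<in> carrier G then \<Sum>x\<in>supp f. f x * g (inv\<^bsub>G\<^esub> x \<otimes>\<^bsub>G\<^esub> z) else 0)"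

definition l2norm :: "('a \<Rightarrow> complex) \<Rightarrow> real" where
  "l2norm f = L2_set (\<lambda>x. cmod (f x)) (supp f)"

definition property_RD :: "('a, 'm) monoid_scheme \<Rightarrow> ('a \<Rightarrow> real) \<Rightarrow> bool" where
  "property_RD G l \<longleftrightarrow>
     (\<exists>P :: real poly. \<forall>r\<ge>0. \<forall>f\<in>group_algebra G. \<forall>g\<in>group_algebra G.
        supp f \<subseteq> length_ball G l r \<longrightarrow>
        l2norm (convolution G f g) \<le> poly P r * l2norm f * l2norm g)"


subsection \<open>Triangles, 3-paths and retracts\<close>

definition triangles :: "('a, 'm) monoid_scheme \<Rightarrow> ('a \<times> 'a \<times> 'a) set" where
  "triangles G =
     {(x, y, z). x \<in> carrier G \<and> y \<in> carrier G \<and> z \<in> carrier G \<and> x \<otimes>\<^bsub>G\<^esub> y = z}"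

text \<open>Paths are read from right to left: the first step is the last component of the triple.\<close>

definition three_paths :: "('a, 'm) monoid_scheme \<Rightarrow> 'a \<Rightarrow> ('a \<times> 'a \<times> 'a) set" where
  "three_paths G z =
     {(a3, a2, a1). a3 \<in> carrier G \<and> a2 \<in> carrier G \<and> a1 \<in> carrier G \<and>
        z = a3 \<otimes>\<^bsub>G\<^esub> a2 \<otimes>\<^bsub>G\<^esub> a1}"

definition geodesic_path ::
  "('a, 'm) monoid_scheme \<Rightarrow> ('a \<Rightarrow> real) \<Rightarrow> real \<Rightarrow> real \<Rightarrow> 'a \<times> 'a \<times> 'a \<Rightarrow> bool" where
  "geodesic_path G l \<kappa> \<delta> = (\<lambda>(a3, a2, a1).
     l a1 + l a2 + l a3 \<le> \<kappa> * l (a3 \<otimes>\<^bsub>G\<^esub> a2 \<otimes>\<^bsub>G\<^esub> a1) + \<delta>)"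

text \<open>A family of sets of 3-paths is encoded as \<open>C r z\<close>; only the values at \<open>r \<ge> 1\<close> and
  \<open>z \<in> carrier G\<close> are relevant.\<close>

type_synonym 'a path_family = "nat \<Rightarrow> 'a \<Rightarrow> ('a \<times> 'a \<times> 'a) set"

definition path_family :: "('a, 'm) monoid_scheme \<Rightarrow> 'a path_family \<Rightarrow> bool" where
  "path_family G C \<longleftrightarrow> (\<forall>r\<ge>1. \<forall>z\<in>carrier G. C r z \<subseteq> three_paths G z)"

definition polynomial_growth :: "('a, 'm) monoid_scheme \<Rightarrow> 'a path_family \<Rightarrow> bool" where
  "polynomial_growth G C \<longleftrightarrow>
     (\<exists>p1 :: real poly. \<forall>r\<ge>1. \<forall>z\<in>carrier G.
        finite (C r z) \<and> real (card (C r z)) \<le> poly p1 (real r))"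

definition triangle_decompositions ::
  "('a, 'm) monoid_scheme \<Rightarrow> 'a path_family \<Rightarrow> nat \<Rightarrow> 'a \<times> 'a \<times> 'a \<Rightarrow> ('a \<times> 'a \<times> 'a) set" where
  "triangle_decompositions G C r = (\<lambda>(u, v, w).
     {(a, b, c). a \<in> carrier G \<and> b \<in> carrier G \<and> c \<in> carrier G \<and>
        (inv\<^bsub>G\<^esub> a, u, b) \<in> C r (inv\<^bsub>G\<^esub> a \<otimes>\<^bsub>G\<^esub> u \<otimes>\<^bsub>G\<^esub> b) \<and>
        (inv\<^bsub>G\<^esub> b, v, c) \<in> C r (inv\<^bsub>G\<^esub> b \<otimes>\<^bsub>G\<^esub> v \<otimes>\<^bsub>G\<^esub> c) \<and>
        (inv\<^bsub>G\<^esub> a, w, c) \<in> C r (inv\<^bsub>G\<^esub> a \<otimes>\<^bsub>G\<^esub> w \<otimes>\<^bsub>G\<^esub> c)})"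

text \<open>\<open>retract_along G l C S' S\<close>: the set of triangles \<open>S'\<close> is a retract of \<open>S\<close> along \<open>C\<close>.
  The third side \<open>y = inv b \<otimes> v \<otimes> c\<close> is then determined by the other two.\<close>

definition retract_along ::
  "('a, 'm) monoid_scheme \<Rightarrow> ('a \<Rightarrow> real) \<Rightarrow> 'a path_family \<Rightarrow>
   ('a \<times> 'a \<times> 'a) set \<Rightarrow> ('a \<times> 'a \<times> 'a) set \<Rightarrow> bool" where
  "retract_along G l C S' S \<longleftrightarrow>
     (\<exists>p2 :: real poly. \<forall>(x, y, z)\<in>S. \<exists>(u, v, w)\<in>S'.
        l u \<le> poly p2 (l x) \<and>
        (\<exists>(a, b, c)\<in>triangle_decompositions G C (max 1 (nat \<lceil>l x\<rceil>)) (u, v, w).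
           inv\<^bsub>G\<^esub> a \<otimes>\<^bsub>G\<^esub> u \<otimes>\<^bsub>G\<^esub> b = x \<and> inv\<^bsub>G\<^esub> a \<otimes>\<^bsub>G\<^esub> w \<otimes>\<^bsub>G\<^esub> c = z))"

definition polynomial_branching :: "('a, 'm) monoid_scheme \<Rightarrow> ('a \<Rightarrow> real) \<Rightarrow> bool" where
  "polynomial_branching G l \<longleftrightarrow>
     (\<exists>\<kappa> \<delta> C S. \<kappa> \<ge> 1 \<and> \<delta> \<ge> 0 \<and>
        path_family G C \<and> polynomial_growth G C \<and>
        (\<forall>r\<ge>1. \<forall>z\<in>carrier G. \<forall>p\<in>C r z. geodesic_path G l \<kappa> \<delta> p) \<and>
        S \<subseteq> triangles G \<and> retract_along G l C S (triangles G) \<and>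
        (\<exists>p3 :: real poly. \<forall>z\<in>carrier G. \<forall>r\<ge>0.
           finite {(x, y, z'). (x, y, z') \<in> S \<and> z' = z \<and> l x \<le> r} \<and>
           real (card {(x, y, z'). (x, y, z') \<in> S \<and> z' = z \<and> l x \<le> r}) \<le> poly p3 r))"

end

theory Submission
  imports Defs "HOL-Analysis.Convex"
begin

text \<open>
  The proof bounds \<open>f * g\<close> at \<open>z\<close>, which is a sum over triangles \<open>(x, y, z)\<close> with
  \<open>x \<in> supp f\<close> and \<open>y \<in> supp g\<close>, by grouping the triangles according to how they retract.
  A triangle \<open>(x, y, z)\<close> retracts to some \<open>(u, v, w) \<in> S\<close> through connecting elements
  \<open>(a, b, c)\<close>: \<open>x = a\<inverse> u b\<close>, \<open>y = b\<inverse> v c\<close> and \<open>z = a\<inverse> w c\<close>. Choose such data for each triangle,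
  and let its key record everything except \<open>b\<close>, together with the integer radius
  \<open>n = max 1 \<lceil>l x\<rceil>\<close> at which the paths are taken. The key keeps enough to recover \<open>z\<close>.

  \<^item> Only polynomially many keys lie above a given \<open>z\<close>: the radius takes at most \<open>r + 1\<close> values if
    \<open>supp f\<close> lies in the ball of radius \<open>r\<close>; the path \<open>(a\<inverse>, w, c)\<close> belongs to \<open>C n z\<close>; and, once
    \<open>w\<close> is known, \<open>(u, v, w)\<close> is a triangle of \<open>S\<close> above \<open>w\<close> with \<open>l u\<close> polynomially bounded.
  \<^item> Triangles with a common key differ only in \<open>b\<close>. Take a pair of them, one with first side \<open>x\<close> and
    one with second side \<open>y\<close>: the pair can be recovered from the path of \<open>x\<close> in \<open>C n x\<close>, which
    gives \<open>a\<close>, \<open>u\<close> and the first \<open>b\<close>, and the path of \<open>y\<close> in \<open>C n y\<close>, which gives \<open>v\<close>, \<open>c\<close> and the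
    second \<open>b\<close>. So for fixed \<open>x\<close> and \<open>y\<close> there are only polynomially many such pairs.

  These two counts are what an iterated Cauchy-Schwarz inequality needs: applied over the keys above
  \<open>z\<close> it costs the first count, and applied inside each fibre it separates \<open>f\<close> from \<open>g\<close>. Summed
  over \<open>z\<close>, the result is a sum of \<open>\<bar>f x\<bar>\<^sup>2 \<bar>g y\<bar>\<^sup>2\<close> over the pairs in the second item. Hence
  \<open>\<parallel>f * g\<parallel>\<^sup>2\<close> is at most the product of the two counts and of \<open>\<parallel>f\<parallel>\<^sup>2 \<parallel>g\<parallel>\<^sup>2\<close>
  (\<open>sum_squares_of_keyed_sums_le\<close>, \<open>l2norm_convolution_le\<close>). The counts are
  \<open>card_keys_above_le\<close> and \<open>card_pairs_with_common_key_le\<close>. Recording the radius in the key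
  lets all sides \<open>x\<close> in \<open>supp f\<close> be treated at once, although their paths are taken at different
  radii.
\<close>

section \<open>Monotone majorants of polynomials\<close>

text \<open>The growth bounds hold at each radius separately, whereas the final bound needs them uniformly
  over all radii up to \<open>r\<close>. Replacing each coefficient by its absolute value makes them monotone.\<close>

lemma polynomial_monotone_majorant:
  fixes p :: "real poly"
  shows "\<exists>q :: real poly. \<forall>s t. 0 \<le> s \<longrightarrow> s \<le> t \<longrightarrow> \<bar>poly p s\<bar> \<le> poly q t"
proof (induction p)
  case 0
  have "\<forall>s t. 0 \<le> s \<longrightarrow> s \<le> t \<longrightarrow> \<bar>poly 0 s :: real\<bar> \<le> poly 0 t" by simp
  then show ?case by blast
next
  case (pCons a p)
  then obtain q :: "real poly"
    where q: "\<And>s t. 0 \<le> s \<Longrightarrow> s \<le> t \<Longrightarrow> \<bar>poly p s\<bar> \<le> poly q t" by blast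
  have "\<bar>poly (pCons a p) s\<bar> \<le> poly (pCons \<bar>a\<bar> q) t" if "0 \<le> s" "s \<le> t" for s t
  proof -
    have "\<bar>a + s * poly p s\<bar> \<le> \<bar>a\<bar> + s * \<bar>poly p s\<bar>"
      using that by (metis abs_mult abs_of_nonneg abs_triangle_ineq)
    also have "s * \<bar>poly p s\<bar> \<le> t * poly q t"
      using that q[OF that] by (intro mult_mono) auto
    finally show ?thesis by simp
  qed
  then show ?case by blast
qed

section \<open>Cauchy-Schwarz along keys\<close>

text \<open>The analytic core: a convolution-like sum is controlled by two counts attached to an arbitrary
  classification of its terms by keys that determine the output index \<open>z\<close>. A coarse key makes
  \<open>M\<close> small and \<open>N\<close> large, a fine key the reverse.\<close>

lemma sum_squares_of_keyed_sums_le: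
  fixes F :: "'a \<Rightarrow> real" and G :: "'b \<Rightarrow> real" and key :: "'a \<times> 'b \<Rightarrow> 'k" and \<pi> :: "'k \<Rightarrow> 'z"
  assumes X: "finite X" and Y: "finite Y"
    and M: "\<And>z. real (card {k \<in> key ` (X \<times> Y). \<pi> k = z}) \<le> M"
    and N: "\<And>x y. x \<in> X \<Longrightarrow> y \<in> Y \<Longrightarrow>
      real (card {(s, t) \<in> (X \<times> Y) \<times> (X \<times> Y). key s = key t \<and> fst s = x \<and> snd t = y}) \<le> N"
    and Z: "finite Z" "\<And>t. t \<in> X \<times> Y \<Longrightarrow> \<pi> (key t) \<in> Z"
  shows "(\<Sum>z\<in>Z. (\<Sum>t | t \<in> X \<times> Y \<and> \<pi> (key t) = z. F (fst t) * G (snd t))\<^sup>2)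
    \<le> M * N * ((\<Sum>x\<in>X. (F x)\<^sup>2) * (\<Sum>y\<in>Y. (G y)\<^sup>2))"
proof -
  define T where "T = X \<times> Y"
  define K where "K = key ` T"
  define fibre where "fibre k = {t \<in> T. key t = k}" for k
  define A where "A k = (\<Sum>t\<in>fibre k. (F (fst t))\<^sup>2)" for k
  define B where "B k = (\<Sum>t\<in>fibre k. (G (snd t))\<^sup>2)" for k
  have T: "finite T" unfolding T_def using X Y by simp
  have K: "finite K" unfolding K_def using T by simp
  have AB: "0 \<le> A k" "0 \<le> B k" for k unfolding A_def B_def by (auto intro: sum_nonneg)
  have M0: "0 \<le> M" using M[of undefined] by (meson of_nat_0_le_iff order_trans)
  \<comment> \<open>Only the number of keys above \<open>z\<close> is paid for in the sum over keys: the sum inside each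
    fibre is split by a second application of Cauchy-Schwarz, at no cost.\<close>
  have over_z: "(\<Sum>t | t \<in> X \<times> Y \<and> \<pi> (key t) = z. F (fst t) * G (snd t))\<^sup>2
      \<le> M * (\<Sum>k | k \<in> K \<and> \<pi> k = z. A k * B k)" for z
  proof -
    define Kz where "Kz = {k \<in> K. \<pi> k = z}"
    define Sk where "Sk k = (\<Sum>t\<in>fibre k. F (fst t) * G (snd t))" for k
    have "(\<Sum>t | t \<in> X \<times> Y \<and> \<pi> (key t) = z. F (fst t) * G (snd t))
        = (\<Sum>k\<in>Kz. \<Sum>t | t \<in> {t. t \<in> T \<and> \<pi> (key t) = z} \<and> key t = k. F (fst t) * G (snd t))"
      unfolding T_def[symmetric]
      by (rule sum.group[symmetric]) (use T K in \<open>auto simp: Kz_def K_def\<close>)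
    also have "\<dots> = (\<Sum>k\<in>Kz. 1 * Sk k)"
      unfolding Sk_def fibre_def by (rule sum.cong) (auto simp: Kz_def intro!: sum.cong)
    finally have "(\<Sum>t | t \<in> X \<times> Y \<and> \<pi> (key t) = z. F (fst t) * G (snd t))\<^sup>2 = (\<Sum>k\<in>Kz. 1 * Sk k)\<^sup>2"
      by simp
    also have "\<dots> \<le> (\<Sum>k\<in>Kz. 1\<^sup>2) * (\<Sum>k\<in>Kz. (Sk k)\<^sup>2)"
      by (rule Cauchy_Schwarz_ineq_sum)
    also have "\<dots> = real (card Kz) * (\<Sum>k\<in>Kz. (Sk k)\<^sup>2)" by simp
    also have "\<dots> \<le> M * (\<Sum>k\<in>Kz. A k * B k)"
    proof (rule mult_mono)
      show "real (card Kz) \<le> M" using M[of z] unfolding Kz_def K_def T_def by simp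
      show "(\<Sum>k\<in>Kz. (Sk k)\<^sup>2) \<le> (\<Sum>k\<in>Kz. A k * B k)"
        unfolding Sk_def A_def B_def by (intro sum_mono Cauchy_Schwarz_ineq_sum)
    qed (auto intro: M0 sum_nonneg)
    finally show ?thesis unfolding Kz_def .
  qed
  have "(\<Sum>z\<in>Z. (\<Sum>t | t \<in> X \<times> Y \<and> \<pi> (key t) = z. F (fst t) * G (snd t))\<^sup>2)
      \<le> (\<Sum>z\<in>Z. M * (\<Sum>k | k \<in> K \<and> \<pi> k = z. A k * B k))"
    by (intro sum_mono over_z)
  also have "\<dots> = M * (\<Sum>k\<in>K. A k * B k)"
    unfolding sum_distrib_left[symmetric]
    by (subst sum.group) (use K Z in \<open>auto simp: K_def T_def\<close>)
  also have "(\<Sum>k\<in>K. A k * B k) \<le> N * ((\<Sum>x\<in>X. (F x)\<^sup>2) * (\<Sum>y\<in>Y. (G y)\<^sup>2))"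
  proof -
    \<comment> \<open>The products of the two fibre sums run over pairs of indices with equal keys; regroup these
      by the two coordinates that the summand depends on.\<close>
    define P where "P = {(s, t) \<in> T \<times> T. key s = key t}"
    define W where "W q = (F (fst (fst q)))\<^sup>2 * (G (snd (snd q)))\<^sup>2" for q :: "('a \<times> 'b) \<times> ('a \<times> 'b)"
    have P: "finite P" unfolding P_def by (rule finite_subset[of _ "T \<times> T"]) (use T in auto)
    have "(\<Sum>k\<in>K. A k * B k) = (\<Sum>k\<in>K. \<Sum>q\<in>fibre k \<times> fibre k. W q)"
      unfolding A_def B_def W_def by (simp add: sum_product sum.cartesian_product case_prod_beta)
    also have "\<dots> = (\<Sum>k\<in>K. \<Sum>q | q \<in> P \<and> key (fst q) = k. W q)"
      by (intro sum.cong) (auto simp: fibre_def P_def)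
    also have "\<dots> = (\<Sum>q\<in>P. W q)"
      by (rule sum.group) (use P K in \<open>auto simp: P_def K_def\<close>)
    also have "\<dots> = (\<Sum>i\<in>X \<times> Y. \<Sum>q | q \<in> P \<and> (fst (fst q), snd (snd q)) = i. W q)"
      by (rule sum.group[symmetric]) (use P X Y in \<open>auto simp: P_def T_def\<close>)
    also have "\<dots> \<le> (\<Sum>i\<in>X \<times> Y. N * ((F (fst i))\<^sup>2 * (G (snd i))\<^sup>2))"
    proof (rule sum_mono)
      fix i assume i: "i \<in> X \<times> Y"
      have "(\<Sum>q | q \<in> P \<and> (fst (fst q), snd (snd q)) = i. W q)
          = real (card {q \<in> P. (fst (fst q), snd (snd q)) = i}) * ((F (fst i))\<^sup>2 * (G (snd i))\<^sup>2)"
        unfolding sum_constant[symmetric] by (rule sum.cong) (auto simp: W_def)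
      also have "\<dots> \<le> N * ((F (fst i))\<^sup>2 * (G (snd i))\<^sup>2)"
      proof (rule mult_right_mono)
        have "{q \<in> P. (fst (fst q), snd (snd q)) = i} =
            {(s, t) \<in> (X \<times> Y) \<times> (X \<times> Y). key s = key t \<and> fst s = fst i \<and> snd t = snd i}"
          by (cases i) (auto simp: P_def T_def)
        then show "real (card {q \<in> P. (fst (fst q), snd (snd q)) = i}) \<le> N"
          using N[of "fst i" "snd i"] i by auto
      qed simp
      finally show "(\<Sum>q | q \<in> P \<and> (fst (fst q), snd (snd q)) = i. W q)
          \<le> N * ((F (fst i))\<^sup>2 * (G (snd i))\<^sup>2)" .
    qed
    also have "\<dots> = N * ((\<Sum>x\<in>X. (F x)\<^sup>2) * (\<Sum>y\<in>Y. (G y)\<^sup>2))"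
      unfolding sum_distrib_left[symmetric]
      by (simp add: sum_product sum.cartesian_product case_prod_beta)
    finally show ?thesis .
  qed
  finally show ?thesis using M0 by (simp add: mult_left_mono mult.assoc)
qed

section \<open>Convolution estimates from keys\<close>

text \<open>Passing to absolute values loses only phases, and puts the convolution into the form of a sum
  over triangles to which Cauchy-Schwarz along keys applies.\<close>

lemma (in group) cmod_convolution_le:
  assumes f: "f \<in> group_algebra G" and g: "g \<in> group_algebra G"
  shows "cmod (convolution G f g z)
    \<le> (\<Sum>t | t \<in> supp f \<times> supp g \<and> fst t \<otimes> snd t = z. cmod (f (fst t)) * cmod (g (snd t)))"
    (is "_ \<le> sum ?h ?T")
proof (cases "z \<in> carrier G")
  case True
  have fin: "finite (supp f)" "finite (supp g)"
    and car: "supp f \<subseteq> carrier G" "supp g \<subseteq> carrier G"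
    using f g by (auto simp: group_algebra_def)
  let ?X = "{x \<in> supp f. inv x \<otimes> z \<in> supp g}"
  have "cmod (convolution G f g z) \<le> (\<Sum>x\<in>supp f. cmod (f x) * cmod (g (inv x \<otimes> z)))"
    unfolding convolution_def using True by (auto intro!: sum_norm_le simp: norm_mult)
  also have "\<dots> = (\<Sum>x\<in>?X. cmod (f x) * cmod (g (inv x \<otimes> z)))"
    by (rule sum.mono_neutral_right) (use fin in \<open>auto simp: supp_def\<close>)
  also have "\<dots> = sum ?h ((\<lambda>x. (x, inv x \<otimes> z)) ` ?X)"
    by (subst sum.reindex) (auto simp: inj_on_def)
  also have "\<dots> \<le> sum ?h ?T"
    by (rule sum_mono2)
      (use fin car True in \<open>auto simp: m_assoc[symmetric] subset_iff
        intro: finite_subset[of _ "supp f \<times> supp g"]\<close>)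
  finally show ?thesis .
next
  case False
  then show ?thesis by (simp add: convolution_def sum_nonneg)
qed

lemma (in group) l2norm_convolution_le:
  fixes key :: "'a \<times> 'a \<Rightarrow> 'k" and \<pi> :: "'k \<Rightarrow> 'a"
  assumes f: "f \<in> group_algebra G" and g: "g \<in> group_algebra G"
    and prod: "\<And>x y. x \<in> supp f \<Longrightarrow> y \<in> supp g \<Longrightarrow> \<pi> (key (x, y)) = x \<otimes> y"
    and M: "\<And>z. real (card {k \<in> key ` (supp f \<times> supp g). \<pi> k = z}) \<le> M"
    and N: "\<And>x y. x \<in> supp f \<Longrightarrow> y \<in> supp g \<Longrightarrow>
      real (card {(s, t) \<in> (supp f \<times> supp g) \<times> (supp f \<times> supp g).
        key s = key t \<and> fst s = x \<and> snd t = y}) \<le> N"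
  shows "l2norm (convolution G f g) \<le> sqrt (M * N) * l2norm f * l2norm g"
proof -
  let ?T = "supp f \<times> supp g"
  define Z where "Z = (\<lambda>t. fst t \<otimes> snd t) ` ?T"
  have fin: "finite (supp f)" "finite (supp g)" using f g by (auto simp: group_algebra_def)
  have Z: "finite Z" unfolding Z_def using fin by simp
  have prod': "\<pi> (key t) = fst t \<otimes> snd t" if "t \<in> ?T" for t using that prod by auto
  have key_Z: "\<pi> (key t) \<in> Z" if "t \<in> ?T" for t
    unfolding Z_def prod'[OF that] using that by (rule imageI)
  have conv: "cmod (convolution G f g z)
      \<le> (\<Sum>t | t \<in> ?T \<and> \<pi> (key t) = z. cmod (f (fst t)) * cmod (g (snd t)))" for z
  proof -
    have eq: "{t. t \<in> ?T \<and> \<pi> (key t) = z} = {t. t \<in> ?T \<and> fst t \<otimes> snd t = z}"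
      using prod' by auto
    show ?thesis unfolding eq by (rule cmod_convolution_le[OF f g])
  qed
  have sub: "supp (convolution G f g) \<subseteq> Z"
  proof
    fix z assume "z \<in> supp (convolution G f g)"
    then have "{t. t \<in> ?T \<and> \<pi> (key t) = z} \<noteq> {}"
      using conv[of z] by (intro notI) (simp only: sum.empty, simp add: supp_def)
    then show "z \<in> Z" using prod' unfolding Z_def by force
  qed
  have "(\<Sum>z\<in>supp (convolution G f g). (cmod (convolution G f g z))\<^sup>2)
      \<le> (\<Sum>z\<in>Z. (cmod (convolution G f g z))\<^sup>2)"
    by (rule sum_mono2[OF Z sub]) simp
  also have "\<dots> \<le> (\<Sum>z\<in>Z. (\<Sum>t | t \<in> ?T \<and> \<pi> (key t) = z. cmod (f (fst t)) * cmod (g (snd t)))\<^sup>2)"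
    by (intro sum_mono power_mono conv) simp
  also have "\<dots> \<le> M * N * ((\<Sum>x\<in>supp f. (cmod (f x))\<^sup>2) * (\<Sum>y\<in>supp g. (cmod (g y))\<^sup>2))"
    by (rule sum_squares_of_keyed_sums_le[OF fin M N Z key_Z])
  finally show ?thesis
    unfolding l2norm_def L2_set_def by (simp add: real_sqrt_mult[symmetric] mult.assoc)
qed

section \<open>Keys of retracted triangles\<close>

text \<open>One retraction is fixed for each triangle, so that triangles can be classified by it. A triangle
  is given by its sides \<open>x\<close> and \<open>y\<close>, and \<open>rad x\<close> is the index at which its three paths are taken.\<close>

locale retraction_choice = group G for G (structure) +
  fixes rad :: "'a \<Rightarrow> nat" and C :: "'a path_family" and S :: "('a \<times> 'a \<times> 'a) set"
    and a b c u v w :: "'a \<Rightarrow> 'a \<Rightarrow> 'a"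
  assumes retraction: "\<lbrakk>x \<in> carrier G; y \<in> carrier G\<rbrakk> \<Longrightarrow>
        b x y \<in> carrier G \<and> w x y \<in> carrier G \<and> (u x y, v x y, w x y) \<in> S \<and>
        inv (a x y) \<otimes> u x y \<otimes> b x y = x \<and> inv (b x y) \<otimes> v x y \<otimes> c x y = y \<and>
        inv (a x y) \<otimes> w x y \<otimes> c x y = x \<otimes> y \<and>
        (inv (a x y), u x y, b x y) \<in> C (rad x) x \<and> (inv (b x y), v x y, c x y) \<in> C (rad x) y \<and>
        (inv (a x y), w x y, c x y) \<in> C (rad x) (x \<otimes> y)"
begin

text \<open>The connecting element \<open>b\<close> is left out on purpose: it is the variable over which the last
  Cauchy-Schwarz inequality sums, and including it would make the number of keys above a point grow
  with the number of triangles.\<close>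

definition key :: "'a \<times> 'a \<Rightarrow> nat \<times> ('a \<times> 'a \<times> 'a) \<times> ('a \<times> 'a \<times> 'a)" where
  "key = (\<lambda>(x, y). (rad x, (inv (a x y), w x y, c x y), (u x y, v x y, w x y)))"

definition apex :: "nat \<times> ('a \<times> 'a \<times> 'a) \<times> ('a \<times> 'a \<times> 'a) \<Rightarrow> 'a" where
  "apex = (\<lambda>(n, (a', w', c'), t). a' \<otimes> w' \<otimes> c')"

lemma apex_key: "\<lbrakk>x \<in> carrier G; y \<in> carrier G\<rbrakk> \<Longrightarrow> apex (key (x, y)) = x \<otimes> y"
  using retraction[of x y] by (simp add: key_def apex_def)

text \<open>A key above \<open>z\<close> consists of a radius, a path in \<open>C n z\<close>, and a triangle of \<open>S\<close> above the
  middle step of that path, so the three bounds multiply.\<close>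

lemma card_keys_above_le:
  assumes X: "X \<subseteq> carrier G" and Y: "Y \<subseteq> carrier G"
    and C: "path_family G C"
    and I: "finite I" "\<And>n. n \<in> I \<Longrightarrow> 1 \<le> n" "rad ` X \<subseteq> I"
    and p: "\<And>n z. \<lbrakk>n \<in> I; z \<in> carrier G\<rbrakk> \<Longrightarrow> finite (C n z) \<and> real (card (C n z)) \<le> p"
    and R: "\<And>x y. \<lbrakk>x \<in> X; y \<in> Y\<rbrakk> \<Longrightarrow> l (u x y) \<le> R"
    and q: "\<And>w'. w' \<in> carrier G \<Longrightarrow>
      finite {(x, y, z'). (x, y, z') \<in> S \<and> z' = w' \<and> l x \<le> R} \<and>
      real (card {(x, y, z'). (x, y, z') \<in> S \<and> z' = w' \<and> l x \<le> R}) \<le> q"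
    and nonneg: "0 \<le> p" "0 \<le> q"
  shows "real (card {k \<in> key ` (X \<times> Y). apex k = z}) \<le> real (card I) * (p * q)"
proof (cases "z \<in> carrier G")
  case True
  define E where "E w' = {(x, y, z'). (x, y, z') \<in> S \<and> z' = w' \<and> l x \<le> R}" for w'
  define L where "L n = (SIGMA p:C n z. E (fst (snd p)))" for n
  have mid: "fst (snd t) \<in> carrier G" if "n \<in> I" "t \<in> C n z" for n t
    using C I(2)[OF that(1)] that True unfolding path_family_def three_paths_def by fastforce
  have L: "finite (L n)" "real (card (L n)) \<le> p * q" if n: "n \<in> I" for n
  proof -
    have fC: "finite (C n z)" using p n True by blast
    have "\<And>t. t \<in> C n z \<Longrightarrow> finite (E (fst (snd t)))" using mid q n unfolding E_def by blast
    then have "finite (L n)" and "card (L n) = (\<Sum>t\<in>C n z. card (E (fst (snd t))))"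
      unfolding L_def using fC by auto
    then have "real (card (L n)) = (\<Sum>t\<in>C n z. real (card (E (fst (snd t)))))" by simp
    also have "\<dots> \<le> (\<Sum>t\<in>C n z. q)"
      by (rule sum_mono) (use q mid n in \<open>auto simp: E_def\<close>)
    also have "\<dots> = real (card (C n z)) * q" by simp
    also have "\<dots> \<le> p * q"
      using p n True nonneg by (intro mult_right_mono) auto
    finally show "real (card (L n)) \<le> p * q" .
    show "finite (L n)" by fact
  qed
  have sub: "{k \<in> key ` (X \<times> Y). apex k = z} \<subseteq> Sigma I L"
  proof
    fix k assume "k \<in> {k \<in> key ` (X \<times> Y). apex k = z}"
    then obtain x y where xy: "x \<in> X" "y \<in> Y" and k: "k = key (x, y)" "apex k = z"
      by auto
    have car: "x \<in> carrier G" "y \<in> carrier G" using xy X Y by auto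
    then have z: "z = x \<otimes> y" using k apex_key by simp
    moreover have "rad x \<in> I" using xy I(3) by blast
    ultimately show "k \<in> Sigma I L" using retraction[OF car] R[OF xy] k(1)
      by (simp add: key_def L_def E_def)
  qed
  have "card {k \<in> key ` (X \<times> Y). apex k = z} \<le> card (Sigma I L)"
    by (rule card_mono[OF _ sub]) (use L I(1) in auto)
  also have "\<dots> = (\<Sum>n\<in>I. card (L n))" using L(1) I(1) by simp
  finally have "real (card {k \<in> key ` (X \<times> Y). apex k = z}) \<le> (\<Sum>n\<in>I. real (card (L n)))"
    unfolding of_nat_sum[symmetric] of_nat_le_iff .
  also have "\<dots> \<le> (\<Sum>n\<in>I. p * q)" by (intro sum_mono L(2))
  finally show ?thesis by simp
next
  case False
  have empty: "{k \<in> key ` (X \<times> Y). apex k = z} = {}"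
  proof -
    have "apex (key (x, y)) \<in> carrier G" if "x \<in> X" "y \<in> Y" for x y
    proof -
      have "x \<in> carrier G" "y \<in> carrier G" using that X Y by auto
      then show ?thesis by (simp add: apex_key)
    qed
    then show ?thesis using False by (auto simp del: split_paired_All)
  qed
  show ?thesis unfolding empty using nonneg by simp
qed

text \<open>Two triangles with a common key share \<open>a\<close>, \<open>c\<close>, \<open>u\<close>, \<open>v\<close>, and their connecting elements \<open>b\<close>
  can be read off from the path of the first side of one and of the second side of the other.
  Since the radius belongs to the key, both of these paths are taken at the radius \<open>rad x\<close>.\<close>

lemma card_pairs_with_common_key_le:
  assumes X: "X \<subseteq> carrier G" and Y: "Y \<subseteq> carrier G" and x: "x \<in> X" and y: "y \<in> Y"
    and p: "\<And>z. z \<in> carrier G \<Longrightarrow> finite (C (rad x) z) \<and> real (card (C (rad x) z)) \<le> p"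
  shows "real (card {(s, t) \<in> (X \<times> Y) \<times> (X \<times> Y). key s = key t \<and> fst s = x \<and> snd t = y}) \<le> p * p"
proof -
  let ?Q = "{(s, t) \<in> (X \<times> Y) \<times> (X \<times> Y). key s = key t \<and> fst s = x \<and> snd t = y}"
  define paths where "paths = (\<lambda>((x1, y1), (x2, y2)).
    ((inv (a x1 y1), u x1 y1, b x1 y1), (inv (b x2 y2), v x2 y2, c x2 y2)))"
  have D: "b x' y' \<in> carrier G \<and>
        inv (a x' y') \<otimes> u x' y' \<otimes> b x' y' = x' \<and> inv (b x' y') \<otimes> v x' y' \<otimes> c x' y' = y' \<and>
        (inv (a x' y'), u x' y', b x' y') \<in> C (rad x') x' \<and>
        (inv (b x' y'), v x' y', c x' y') \<in> C (rad x') y'"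
    if "x' \<in> X" "y' \<in> Y" for x' y'
    using retraction[of x' y'] that X Y by blast
  have inj: "inj_on paths ?Q"
  proof (rule inj_onI)
    fix s t assume s: "s \<in> ?Q" and t: "t \<in> ?Q" and eq: "paths s = paths t"
    obtain y1 x2 where s': "s = ((x, y1), (x2, y))" using s by auto
    obtain y1' x2' where t': "t = ((x, y1'), (x2', y))" using t by auto
    have m: "x2 \<in> X" "x2' \<in> X" "y1 \<in> Y" "y1' \<in> Y"
      using s t s' t' by auto
    note d = D[OF x m(3)] D[OF x m(4)] D[OF m(1) y] D[OF m(2) y]
    have ks: "key (x, y1) = key (x2, y)" "key (x, y1') = key (x2', y)" using s t s' t' by auto
    have e: "b x y1 = b x y1'" "inv (b x2 y) = inv (b x2' y)" "v x2 y = v x2' y" "c x2 y = c x2' y"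
        "inv (a x y1) = inv (a x y1')" "u x y1 = u x y1'"
      using eq unfolding s' t' paths_def by auto
    have k: "v x y1 = v x2 y" "c x y1 = c x2 y" "v x y1' = v x2' y" "c x y1' = c x2' y"
        "inv (a x y1) = inv (a x2 y)" "u x y1 = u x2 y"
        "inv (a x y1') = inv (a x2' y)" "u x y1' = u x2' y"
      using ks unfolding key_def by auto
    have "y1 = inv (b x y1) \<otimes> v x y1 \<otimes> c x y1" using d(1) by simp
    also have "\<dots> = inv (b x y1') \<otimes> v x y1' \<otimes> c x y1'" using e k by simp
    also have "\<dots> = y1'" using d(2) by simp
    finally have "y1 = y1'" .
    have bb: "b x2 y = b x2' y" using e(2) d(3,4) inv_inv by metis
    have "x2 = inv (a x2 y) \<otimes> u x2 y \<otimes> b x2 y" using d(3) by simp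
    also have "\<dots> = inv (a x2' y) \<otimes> u x2' y \<otimes> b x2' y"
      unfolding k(5-8)[symmetric] e(5,6) bb ..
    also have "\<dots> = x2'" using d(4) by simp
    finally show "s = t" using \<open>y1 = y1'\<close> s' t' by simp
  qed
  have sub: "paths ` ?Q \<subseteq> C (rad x) x \<times> C (rad x) y"
  proof
    fix q assume "q \<in> paths ` ?Q"
    then obtain y1 x2 where q: "q = paths ((x, y1), (x2, y))" "key (x, y1) = key (x2, y)"
        and m: "y1 \<in> Y" "x2 \<in> X" by auto
    have "rad x2 = rad x" using q(2) by (simp add: key_def)
    then show "q \<in> C (rad x) x \<times> C (rad x) y"
      using D[OF x m(1)] D[OF m(2) y] unfolding q(1) paths_def by simp
  qed
  have C: "finite (C (rad x) x)" "finite (C (rad x) y)"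
      "real (card (C (rad x) x)) \<le> p" "real (card (C (rad x) y)) \<le> p"
    using p x y X Y by blast+
  have "card ?Q \<le> card (C (rad x) x \<times> C (rad x) y)"
    by (rule card_inj_on_le[OF inj sub]) (use C in simp)
  then have "real (card ?Q) \<le> real (card (C (rad x) x)) * real (card (C (rad x) y))"
    unfolding card_cartesian_product of_nat_mult[symmetric] of_nat_le_iff .
  also have "\<dots> \<le> p * p"
    using C(3,4) by (intro mult_mono) (auto intro: order_trans[OF of_nat_0_le_iff])
  finally show ?thesis .
qed

end

text \<open>The third side is implicit in a retraction: the equations for the sides \<open>x\<close> and \<open>z\<close> force
  \<open>b\<inverse> v c = y\<close> by cancellation.\<close>

lemma (in group) retraction_choice_exists:
  assumes S: "S \<subseteq> triangles G" "retract_along G l C S (triangles G)"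
  obtains p2 :: "real poly" and a b c u v w where
    "retraction_choice G (\<lambda>x. max 1 (nat \<lceil>l x\<rceil>)) C S a b c u v w"
    "\<And>x y. \<lbrakk>x \<in> carrier G; y \<in> carrier G\<rbrakk> \<Longrightarrow> l (u x y) \<le> poly p2 (l x)"
proof -
  define rad where "rad = (\<lambda>x. max 1 (nat \<lceil>l x\<rceil>))"
  from S(2) obtain p2 :: "real poly" where p2: "\<forall>(x, y, z)\<in>triangles G. \<exists>(u, v, w)\<in>S.
        l u \<le> poly p2 (l x) \<and>
        (\<exists>(a, b, c)\<in>triangle_decompositions G C (rad x) (u, v, w).
           inv a \<otimes> u \<otimes> b = x \<and> inv a \<otimes> w \<otimes> c = z)"
    unfolding retract_along_def rad_def by blast
  have "\<exists>a b c u v w. b \<in> carrier G \<and> w \<in> carrier G \<and> (u, v, w) \<in> S \<and> l u \<le> poly p2 (l x) \<and>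
        inv a \<otimes> u \<otimes> b = x \<and> inv b \<otimes> v \<otimes> c = y \<and> inv a \<otimes> w \<otimes> c = x \<otimes> y \<and>
        (inv a, u, b) \<in> C (rad x) x \<and> (inv b, v, c) \<in> C (rad x) y \<and>
        (inv a, w, c) \<in> C (rad x) (x \<otimes> y)"
    if xy: "x \<in> carrier G" "y \<in> carrier G" for x y
  proof -
    have "(x, y, x \<otimes> y) \<in> triangles G" using xy by (simp add: triangles_def)
    from bspec[OF p2 this] obtain u v w a b c where *: "(u, v, w) \<in> S" "l u \<le> poly p2 (l x)"
        "(a, b, c) \<in> triangle_decompositions G C (rad x) (u, v, w)"
        "inv a \<otimes> u \<otimes> b = x" "inv a \<otimes> w \<otimes> c = x \<otimes> y"
      by auto
    have uvw: "u \<in> carrier G" "v \<in> carrier G" "w = u \<otimes> v" using *(1) S(1) by (auto simp: triangles_def)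
    have abc: "a \<in> carrier G" "b \<in> carrier G" "c \<in> carrier G"
      using *(3) by (auto simp: triangle_decompositions_def)
    have "x \<otimes> (inv b \<otimes> v \<otimes> c) = inv a \<otimes> u \<otimes> (b \<otimes> inv b) \<otimes> v \<otimes> c"
      unfolding *(4)[symmetric] using abc uvw(1,2) by (simp add: m_assoc del: r_inv Units_r_inv)
    also have "\<dots> = inv a \<otimes> w \<otimes> c" using abc uvw by (simp add: m_assoc)
    also have "\<dots> = x \<otimes> y" by fact
    finally have y: "inv b \<otimes> v \<otimes> c = y" using xy abc uvw by simp
    have "(inv a, u, b) \<in> C (rad x) x" "(inv b, v, c) \<in> C (rad x) y"
        "(inv a, w, c) \<in> C (rad x) (x \<otimes> y)"
      using *(3) unfolding triangle_decompositions_def by (simp_all only: *(4,5) y split mem_Collect_eq)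
    moreover have "w \<in> carrier G" using uvw by simp
    ultimately show ?thesis using *(1,2,4,5) abc(2) y by blast
  qed
  then obtain a b c u v w where choice: "\<And>x y. \<lbrakk>x \<in> carrier G; y \<in> carrier G\<rbrakk> \<Longrightarrow>
        b x y \<in> carrier G \<and> w x y \<in> carrier G \<and> (u x y, v x y, w x y) \<in> S \<and>
        l (u x y) \<le> poly p2 (l x) \<and>
        inv (a x y) \<otimes> u x y \<otimes> b x y = x \<and> inv (b x y) \<otimes> v x y \<otimes> c x y = y \<and>
        inv (a x y) \<otimes> w x y \<otimes> c x y = x \<otimes> y \<and>
        (inv (a x y), u x y, b x y) \<in> C (rad x) x \<and> (inv (b x y), v x y, c x y) \<in> C (rad x) y \<and>
        (inv (a x y), w x y, c x y) \<in> C (rad x) (x \<otimes> y)"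
    by metis
  have "retraction_choice G rad C S a b c u v w"
    by unfold_locales (use choice in blast)
  then show thesis unfolding rad_def by (rule that) (use choice in blast)
qed

section \<open>Polynomial branching implies property RD\<close>

theorem proposition3:
  fixes G :: "('a, 'm) monoid_scheme" and l :: "'a \<Rightarrow> real"
  assumes "group G"
    and "countable (carrier G)"
    and "length_function G l"
    and "polynomial_branching G l"
  shows "property_RD G l"
proof -
  interpret group G by fact
  obtain C S where C: "path_family G C" "polynomial_growth G C"
    and S: "S \<subseteq> triangles G" "retract_along G l C S (triangles G)"
    and branch: "\<exists>p3 :: real poly. \<forall>z\<in>carrier G. \<forall>r\<ge>0.
           finite {(x, y, z'). (x, y, z') \<in> S \<and> z' = z \<and> l x \<le> r} \<and>
           real (card {(x, y, z'). (x, y, z') \<in> S \<and> z' = z \<and> l x \<le> r}) \<le> poly p3 r"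
    using assms(4) unfolding polynomial_branching_def by blast
  have l0: "0 \<le> l x" if "x \<in> carrier G" for x
    using assms(3) that unfolding length_function_def by blast
  define rad where "rad = (\<lambda>x. max 1 (nat \<lceil>l x\<rceil>))"
  have rad1: "1 \<le> rad x" for x by (simp add: rad_def)
  from C(2) obtain p1 :: "real poly" where p1: "\<And>n z. \<lbrakk>1 \<le> n; z \<in> carrier G\<rbrakk> \<Longrightarrow>
      finite (C n z) \<and> real (card (C n z)) \<le> poly p1 (real n)"
    unfolding polynomial_growth_def by blast
  obtain p2 :: "real poly" and a b c u v w where
      "retraction_choice G rad C S a b c u v w"
      and p2: "\<And>x y. \<lbrakk>x \<in> carrier G; y \<in> carrier G\<rbrakk> \<Longrightarrow> l (u x y) \<le> poly p2 (l x)"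
    unfolding rad_def by (rule retraction_choice_exists[OF S]) blast
  then interpret retraction_choice G rad C S a b c u v w by simp
  from branch obtain p3 :: "real poly" where p3: "\<And>z r. \<lbrakk>z \<in> carrier G; r \<ge> 0\<rbrakk> \<Longrightarrow>
      finite {(x, y, z'). (x, y, z') \<in> S \<and> z' = z \<and> l x \<le> r} \<and>
      real (card {(x, y, z'). (x, y, z') \<in> S \<and> z' = z \<and> l x \<le> r}) \<le> poly p3 r"
    by blast
  obtain q1 :: "real poly" where q1: "\<And>s t. 0 \<le> s \<Longrightarrow> s \<le> t \<Longrightarrow> \<bar>poly p1 s\<bar> \<le> poly q1 t"
    using polynomial_monotone_majorant by blast
  obtain q2 :: "real poly" where q2: "\<And>s t. 0 \<le> s \<Longrightarrow> s \<le> t \<Longrightarrow> \<bar>poly p2 s\<bar> \<le> poly q2 t"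
    using polynomial_monotone_majorant by blast
  obtain q3 :: "real poly" where q3: "\<And>s t. 0 \<le> s \<Longrightarrow> s \<le> t \<Longrightarrow> \<bar>poly p3 s\<bar> \<le> poly q3 t"
    using polynomial_monotone_majorant by blast
  define M where "M r = (r + 1) * (poly q1 (r + 1) * poly q3 (poly q2 r))" for r
  define N where "N r = poly q1 (r + 1) * poly q1 (r + 1)" for r
  \<comment> \<open>This is \<open>1 + M r * N r\<close> as a polynomial in \<open>r\<close>, which dominates the square root of
    \<open>M r * N r\<close>.\<close>
  define P where "P = 1 + [:1, 1:] * (pcompose q1 [:1, 1:]) ^ 3 * pcompose q3 q2"
  have bound: "l2norm (convolution G f g) \<le> poly P r * l2norm f * l2norm g"
    if r: "0 \<le> r" and f: "f \<in> group_algebra G" and g: "g \<in> group_algebra G"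
      and ball: "supp f \<subseteq> length_ball G l r" for r f g
  proof -
    have lx: "l x \<le> r" if "x \<in> supp f" for x
      using ball that by (auto simp: length_ball_def)
    have car: "supp f \<subseteq> carrier G" "supp g \<subseteq> carrier G"
      using f g by (auto simp: group_algebra_def)
    have Q1: "0 \<le> poly q1 (r + 1)" using q1[of "r + 1" "r + 1"] r by simp
    have Q2: "0 \<le> poly q2 r" using q2[of r r] r by simp
    have Q3: "0 \<le> poly q3 (poly q2 r)" using q3[OF Q2 order_refl] by simp
    \<comment> \<open>For \<open>l x \<le> r\<close> the index \<open>max 1 \<lceil>l x\<rceil>\<close> can exceed \<open>r\<close>, but not \<open>r + 1\<close>.\<close>
    define I where "I = {1..nat \<lfloor>r + 1\<rfloor>}"
    have I: "1 \<le> n" "real n \<le> r + 1" if "n \<in> I" for n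
      using that r unfolding I_def atLeastAtMost_iff by linarith+
    have rad_I: "rad x \<in> I" if "x \<in> supp f" for x
    proof -
      have "real (rad x) \<le> r + 1" using lx[OF that] r unfolding rad_def by linarith
      then show ?thesis using rad1[of x] unfolding I_def atLeastAtMost_iff by linarith
    qed
    have cardI: "real (card I) \<le> r + 1" unfolding I_def using r by simp
    have cardC: "finite (C n z) \<and> real (card (C n z)) \<le> poly q1 (r + 1)"
      if "n \<in> I" "z \<in> carrier G" for n z
      using p1[OF I(1)[OF that(1)] that(2)] q1[OF _ I(2)[OF that(1)]] by fastforce
    have keys: "real (card {k \<in> key ` (supp f \<times> supp g). apex k = z}) \<le> M r" for z
    proof -
      have "real (card {k \<in> key ` (supp f \<times> supp g). apex k = z})
          \<le> real (card I) * (poly q1 (r + 1) * poly q3 (poly q2 r))"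
      proof (rule card_keys_above_le[OF car C(1) _ I(1) _ cardC _ _ Q1 Q3])
        show "l (u x y) \<le> poly q2 r" if "x \<in> supp f" "y \<in> supp g" for x y
        proof -
          have xy: "x \<in> carrier G" "y \<in> carrier G" using car that by auto
          show ?thesis using p2[OF xy] q2[OF l0[OF xy(1)] lx[OF that(1)]] by linarith
        qed
        show "finite {(x, y, z'). (x, y, z') \<in> S \<and> z' = w' \<and> l x \<le> poly q2 r} \<and>
            real (card {(x, y, z'). (x, y, z') \<in> S \<and> z' = w' \<and> l x \<le> poly q2 r})
              \<le> poly q3 (poly q2 r)" if "w' \<in> carrier G" for w'
          using p3[OF that Q2] q3[OF Q2 order_refl] by linarith
      qed (use rad_I in \<open>auto simp: I_def\<close>)
      also have "\<dots> \<le> M r"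
        unfolding M_def using cardI Q1 Q3 by (intro mult_right_mono) auto
      finally show ?thesis .
    qed
    have pairs: "real (card {(s, t) \<in> (supp f \<times> supp g) \<times> (supp f \<times> supp g).
        key s = key t \<and> fst s = x \<and> snd t = y}) \<le> N r"
      if "x \<in> supp f" "y \<in> supp g" for x y
      unfolding N_def
      by (rule card_pairs_with_common_key_le[OF car that cardC[OF rad_I[OF that(1)]]])
    have "l2norm (convolution G f g) \<le> sqrt (M r * N r) * l2norm f * l2norm g"
      by (rule l2norm_convolution_le[OF f g _ keys pairs])
        (use apex_key car in auto)
    also have "sqrt (M r * N r) \<le> poly P r"
    proof -
      have nonneg: "0 \<le> M r * N r" unfolding M_def N_def using r Q1 Q3 by simp
      have "sqrt (M r * N r) \<le> 1 + M r * N r"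
      proof (rule real_le_lsqrt)
        have "0 \<le> (M r * N r)\<^sup>2" by (rule zero_le_power2)
        then show "M r * N r \<le> (1 + M r * N r)\<^sup>2"
          using nonneg unfolding power2_sum by simp
      qed (use nonneg in simp)
      also have "\<dots> = poly P r"
        unfolding P_def M_def N_def
        by (simp add: poly_pcompose power3_eq_cube algebra_simps)
      finally show ?thesis .
    qed
    finally show ?thesis
      by (simp add: mult_right_mono l2norm_def)
  qed
  show ?thesis unfolding property_RD_def using bound by blast
qed

end
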